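(* Let $\mathbbm M=\mathcal G^*/R$ be a finitely generated effective group with finite generating set $\mathcal G$, let $\mathcal A$ be a finite alphabet with at least two letters, and let $X\subseteq\mathcal A^{\mathbbm M}$ be a subshift. Then the equality problem of the endomorphism monoid $\mathrm{End}(X)$ (with endomorphisms given by block maps) is positive-reducible to the colanguage $\complement\mathcal L(X)$ of $X$.
   Context: Groups/monoids: $\mathcal G\subseteq\mathbb N$ finite, $\mathcal G^*$ the free monoid on $\mathcal G$, $R$ a monoid congruence with $\mathbbm M=\mathcal G^*/R$ a group, $\pi:\mathcal G^*\to\mathbbm M$ the quotient map; $\mathbbm M$ is an effective group if there is a computable $\psi:\mathcal G^*\to\mathcal G^*$ with $\pi(i\psi(i))=\pi(\psi(i)i)=$ identity. The equality problem of a monoid presented as $\mathcal H^*/R'$ (generating set $\mathcal H$, possibly countable and identified with a subset of $\mathbb N$) is the set of pairs of words $(i,j)\in(\mathcal H^* )^2$ representing the same element. Subshifts: $\mathbbm M$ acts on $\mathcal A^{\mathbbm M}$ (product topology) by $\sigma^i(x)_j=x_{ij}$; a subshift is a closed shift-invariant subset. A pattern is $w\in\mathcal A^W$ with $W\subseteq\mathcal G^*$ finite; the language $\mathcal L(X)$ is the set of patterns $w\in\mathcal A^W$ ($W\subseteq\mathcal G^*$ finite) such that some $x\in X$ satisfies $x_{\pi(i)}=w_i$ for all $i\in W$; the colanguage $\complement\mathcal L(X)$ is the set of all other patterns. $\mathrm{End}(X)$ is the monoid of continuous shift-commuting maps $X\to X$. Each endomorphism is given by a block map $\phi:\mathcal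 A^{\mathcal G^{\le r}}\to\mathcal A$ (for some radius $r$, $\mathcal G^{\le r}$ the words of length $\le r$) via $\Phi(x)_{\pi(i)}=\phi\big((x_{\pi(ij)})_{j\in\mathcal G^{\le r}}\big)$; block maps are enumerated by increasing radius and then lexicographically, and $\mathrm{End}(X)$ is viewed as a monoid generated by the (indices of) block maps defining endomorphisms of $X$, so its equality problem is the set of pairs of finite sequences of such block maps whose compositions define the same endomorphism of $X$. Reducibility: $P$ is positive-reducible to $Q$ if from any $x$ one can compute finitely many finite sets $Q_0(x),\dots,Q_{n-1}(x)$ such that $x\in P$ iff $Q_k(x)\subseteq Q$ for some $k<n$. *)

theory Defs
  imports "HOL-Analysis.Analysis" "HOL-Algebra.Group" "HOL-Library.Nat_Bijection"
begin

section \<open>Computability\<close>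

text \<open>
  Total recursive functions of arity \<open>n\<close>: the least class containing the basic functions and
  closed under composition, primitive recursion and minimization of regular functions.
  A function of arity \<open>n\<close> is represented on lists; only its values on lists of length \<open>n\<close> matter.
\<close>

inductive recursive :: "nat \<Rightarrow> (nat list \<Rightarrow> nat) \<Rightarrow> bool" where
  zero: "recursive n (\<lambda>xs. 0)"
| succ: "recursive 1 (\<lambda>xs. Suc (xs ! 0))"
| proj: "i < n \<Longrightarrow> recursive n (\<lambda>xs. xs ! i)"
| comp: "recursive (length gs) f \<Longrightarrow> (\<forall>g\<in>set gs. recursive n g) \<Longrightarrow>
           recursive n (\<lambda>xs. f (map (\<lambda>g. g xs) gs))"
| prec: "recursive n f \<Longrightarrow> recursive (Suc (Suc n)) g \<Longrightarrow>
           recursive (Suc n) (\<lambda>xs. rec_nat (f (tl xs)) (\<lambda>k v. g (k # v # tl xs)) (hd xs))"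
| mini: "recursive (Suc n) f \<Longrightarrow> (\<forall>xs. length xs = n \<longrightarrow> (\<exists>y. f (y # xs) = 0)) \<Longrightarrow>
           recursive n (\<lambda>xs. LEAST y. f (y # xs) = 0)"

definition computable :: "(nat \<Rightarrow> nat) \<Rightarrow> bool" where
  "computable f \<longleftrightarrow> (\<exists>g. recursive 1 g \<and> (\<forall>x. f x = g [x]))"

text \<open>
  \<open>I\<close> is the set of instances of the problem \<open>P \<subseteq> I\<close>. The value \<open>f x\<close> codes the finite list of
  finite sets \<open>Q\<^sub>0(x), \<dots>, Q\<^sub>n\<^sub>-\<^sub>1(x)\<close>, each set by its canonical index.
\<close>

definition positive_reducible :: "nat set \<Rightarrow> nat set \<Rightarrow> nat set \<Rightarrow> bool" where
  "positive_reducible I P Q \<longleftrightarrow>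
     (\<exists>f. computable f \<and>
        (\<forall>x\<in>I. x \<in> P \<longleftrightarrow> (\<exists>s\<in>set (list_decode (f x)). set_decode s \<subseteq> Q)))"


section \<open>Presented monoids and equality problems\<close>

definition monoid_congruence :: "nat set \<Rightarrow> (nat list \<times> nat list) set \<Rightarrow> bool" where
  "monoid_congruence G R \<longleftrightarrow> equiv (lists G) R \<and>
     (\<forall>u u' v v'. (u, u') \<in> R \<longrightarrow> (v, v') \<in> R \<longrightarrow> (u @ v, u' @ v') \<in> R)"

definition proj_class :: "(nat list \<times> nat list) set \<Rightarrow> nat list \<Rightarrow> nat list set" where
  "proj_class R u = R `` {u}"

definition quotient_monoid :: "nat set \<Rightarrow> (nat list \<times> nat list) set \<Rightarrow> nat list set monoid" where
  "quotient_monoid G R =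
     \<lparr>carrier = lists G // R,
      mult = (\<lambda>U V. \<Union>u\<in>U. \<Union>v\<in>V. proj_class R (u @ v)),
      one = proj_class R []\<rparr>"

definition effective_group :: "nat set \<Rightarrow> (nat list \<times> nat list) set \<Rightarrow> bool" where
  "effective_group G R \<longleftrightarrow> group (quotient_monoid G R) \<and>
     (\<exists>\<psi> p. \<psi> \<in> lists G \<rightarrow> lists G \<and>
        computable p \<and> (\<forall>u\<in>lists G. p (list_encode u) = list_encode (\<psi> u)) \<and>
        (\<forall>u\<in>lists G. proj_class R (u @ \<psi> u) = \<one>\<^bsub>quotient_monoid G R\<^esub> \<and>
                      proj_class R (\<psi> u @ u) = \<one>\<^bsub>quotient_monoid G R\<^esub>))"

definition word_value :: "('a, 'b) monoid_scheme \<Rightarrow> (nat \<Rightarrow> 'a) \<Rightarrow> nat list \<Rightarrow> 'a" where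
  "word_value M \<gamma> u = foldr (\<lambda>h m. \<gamma> h \<otimes>\<^bsub>M\<^esub> m) u \<one>\<^bsub>M\<^esub>"

text \<open>The generators of \<open>M\<close> are the elements \<open>\<gamma> h\<close> with \<open>h \<in> H\<close>.\<close>

definition equality_problem ::
  "('a, 'b) monoid_scheme \<Rightarrow> nat set \<Rightarrow> (nat \<Rightarrow> 'a) \<Rightarrow> (nat list \<times> nat list) set" where
  "equality_problem M H \<gamma> =
     {(u, v) \<in> lists H \<times> lists H. word_value M \<gamma> u = word_value M \<gamma> v}"

definition word_pair_encode :: "nat list \<times> nat list \<Rightarrow> nat" where
  "word_pair_encode = (\<lambda>(u, v). prod_encode (list_encode u, list_encode v))"


section \<open>Subshifts\<close>

type_synonym config = "nat list set \<Rightarrow> nat"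

definition full_shift ::
  "nat set \<Rightarrow> (nat list \<times> nat list) set \<Rightarrow> nat set \<Rightarrow> config topology" where
  "full_shift G R A =
     product_topology (\<lambda>_. discrete_topology A) (carrier (quotient_monoid G R))"

definition shift ::
  "nat set \<Rightarrow> (nat list \<times> nat list) set \<Rightarrow> nat list set \<Rightarrow> config \<Rightarrow> config" where
  "shift G R i x = (\<lambda>j\<in>carrier (quotient_monoid G R). x (i \<otimes>\<^bsub>quotient_monoid G R\<^esub> j))"

definition subshift ::
  "nat set \<Rightarrow> (nat list \<times> nat list) set \<Rightarrow> nat set \<Rightarrow> config set \<Rightarrow> bool" where
  "subshift G R A X \<longleftrightarrow> closedin (full_shift G R A) X \<and>
     (\<forall>i\<in>carrier (quotient_monoid G R). \<forall>x\<in>X. shift G R i x \<in> X)"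

text \<open>A pattern \<open>w \<in> A\<^sup>W\<close> is a finite partial map whose domain is the support \<open>W\<close>.\<close>

definition patterns :: "nat set \<Rightarrow> nat set \<Rightarrow> (nat list \<rightharpoonup> nat) set" where
  "patterns G A = {w. finite (dom w) \<and> dom w \<subseteq> lists G \<and> ran w \<subseteq> A}"

definition language ::
  "nat set \<Rightarrow> (nat list \<times> nat list) set \<Rightarrow> nat set \<Rightarrow> config set \<Rightarrow> (nat list \<rightharpoonup> nat) set" where
  "language G R A X =
     {w \<in> patterns G A. \<exists>x\<in>X. \<forall>i\<in>dom w. w i = Some (x (proj_class R i))}"

definition colanguage ::
  "nat set \<Rightarrow> (nat list \<times> nat list) set \<Rightarrow> nat set \<Rightarrow> config set \<Rightarrow> (nat list \<rightharpoonup> nat) set" where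
  "colanguage G R A X = patterns G A - language G R A X"

definition pattern_encode :: "(nat list \<rightharpoonup> nat) \<Rightarrow> nat" where
  "pattern_encode w =
     set_encode ((\<lambda>(i, a). prod_encode (list_encode i, a)) ` Map.graph w)"


section \<open>Endomorphisms and block maps\<close>

definition End_monoid ::
  "nat set \<Rightarrow> (nat list \<times> nat list) set \<Rightarrow> nat set \<Rightarrow> config set \<Rightarrow> (config \<Rightarrow> config) monoid" where
  "End_monoid G R A X =
     \<lparr>carrier = {F \<in> extensional X.
        continuous_map (subtopology (full_shift G R A) X) (subtopology (full_shift G R A) X) F \<and>
        (\<forall>i\<in>carrier (quotient_monoid G R). \<forall>x\<in>X. F (shift G R i x) = shift G R i (F x))},
      mult = compose X,
      one = (\<lambda>x\<in>X. x)\<rparr>"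

text \<open>
  Since \<open>product_lists\<close> lists tuples lexicographically, \<open>ball_words G r\<close> lists the words of length
  at most \<open>r\<close> by length and then lexicographically; \<open>local_patterns G A r\<close> lists \<open>A\<close>-valued tuples
  indexed by these words, and \<open>block_tables G A r\<close> lists the value tables, indexed by the local
  patterns, of the block maps of radius \<open>r\<close>, both lexicographically.
\<close>

definition ball_words :: "nat set \<Rightarrow> nat \<Rightarrow> nat list list" where
  "ball_words G r =
     concat (map (\<lambda>k. product_lists (replicate k (sorted_list_of_set G))) [0..<Suc r])"

definition local_patterns :: "nat set \<Rightarrow> nat set \<Rightarrow> nat \<Rightarrow> nat list list" where
  "local_patterns G A r =
     product_lists (replicate (length (ball_words G r)) (sorted_list_of_set A))"

definition block_tables :: "nat set \<Rightarrow> nat set \<Rightarrow> nat \<Rightarrow> nat list list" where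
  "block_tables G A r =
     product_lists (replicate (length (local_patterns G A r)) (sorted_list_of_set A))"

text \<open>
  Each radius contributes at least one table when \<open>A\<close> is nonempty, so the entry of index \<open>n\<close> in the
  enumeration by increasing radius is found among the radii at most \<open>n\<close>.
\<close>

definition block_map_enum :: "nat set \<Rightarrow> nat set \<Rightarrow> nat \<Rightarrow> nat \<times> nat list" where
  "block_map_enum G A n =
     concat (map (\<lambda>r. map (Pair r) (block_tables G A r)) [0..<Suc n]) ! n"

definition block_radius :: "nat set \<Rightarrow> nat set \<Rightarrow> nat \<Rightarrow> nat" where
  "block_radius G A n = fst (block_map_enum G A n)"

definition block_map :: "nat set \<Rightarrow> nat set \<Rightarrow> nat \<Rightarrow> (nat list \<Rightarrow> nat) \<Rightarrow> nat" where
  "block_map G A n =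
     (\<lambda>w\<in>set (ball_words G (block_radius G A n)) \<rightarrow>\<^sub>E A.
        the (map_of (zip (local_patterns G A (block_radius G A n)) (snd (block_map_enum G A n)))
              (map w (ball_words G (block_radius G A n)))))"

text \<open>At \<open>g = proj_class R i\<close> the argument \<open>g \<otimes> proj_class R j\<close> is \<open>proj_class R (i @ j)\<close>.\<close>

definition block_endo ::
  "nat set \<Rightarrow> (nat list \<times> nat list) set \<Rightarrow> nat set \<Rightarrow> config set \<Rightarrow> nat \<Rightarrow> config \<Rightarrow> config" where
  "block_endo G R A X n =
     (\<lambda>x\<in>X. \<lambda>g\<in>carrier (quotient_monoid G R).
        block_map G A n
          (\<lambda>j\<in>set (ball_words G (block_radius G A n)).
             x (g \<otimes>\<^bsub>quotient_monoid G R\<^esub> proj_class R j)))"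

definition endo_indices ::
  "nat set \<Rightarrow> (nat list \<times> nat list) set \<Rightarrow> nat set \<Rightarrow> config set \<Rightarrow> nat set" where
  "endo_indices G R A X = {n. block_endo G R A X n \<in> carrier (End_monoid G R A X)}"

end

theory Submission
  imports Defs
begin

text \<open>
  Let \<open>u\<close> and \<open>v\<close> be words of block maps and let \<open>s\<close> be the sum of all their radii. By shift
  invariance the two composed endomorphisms agree on \<open>X\<close> iff their values at the identity agree, and
  these depend only on the cells indexed by words of length at most \<open>s\<close>. Hence they are equal iff
  every pattern on these words that the two composed block maps send to different letters lies in the
  colanguage; patterns giving different letters to words with the same value in the group do so for
  free. These finitely many patterns form a single computable finite set, so one \<open>Q\<^sub>0\<close> suffices.
\<close>

text \<open>The word problem of the group may be undecidable, so the algorithm never compares group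
  elements. It computes with one value per word, as if different words named different cells, and
  cannot discard inconsistent candidates. The presentation enters only the correctness proof.

  A block map of radius \<open>r\<close> needs cells \<open>r\<close> letters further out. Inside a
  fixed finite ball the computed values are therefore reliable only on a smaller ball, which shrinks
  with every letter applied; the ball is chosen so that the empty word is still reliable at the end,
  for both words at once.

  The other obstacle is computability itself: \<open>recursive\<close> knows only functions on lists
  of naturals, while the procedure handles tables, association lists and lists of lists. The
  predicate \<open>effective\<close>, for functions between types with fixed injective codes,
  bridges the gap. It is closed under the list operations in use, so computability of the procedure
  can be read off its defining term.\<close>

section \<open>Closure properties of the recursive functions\<close>

text \<open>\<open>recursive\<close> is sensitive to values on lists of every length, although only
  length \<open>n\<close> is meaningful. Agreement on length \<open>n\<close> restores the freedom
  to replace a function by an equal one.\<close>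

definition recursive_on :: "nat \<Rightarrow> (nat list \<Rightarrow> nat) \<Rightarrow> bool" where
  "recursive_on n f \<longleftrightarrow> (\<exists>g. recursive n g \<and> (\<forall>xs. length xs = n \<longrightarrow> f xs = g xs))"

lemma recursive_onI: "recursive n f \<Longrightarrow> recursive_on n f"
  by (auto simp: recursive_on_def)

lemma recursive_on_cong:
  "recursive_on n f \<Longrightarrow> (\<And>xs. length xs = n \<Longrightarrow> f xs = g xs) \<Longrightarrow> recursive_on n g"
  unfolding recursive_on_def by metis

lemma recursive_on_proj: "i < n \<Longrightarrow> recursive_on n (\<lambda>xs. xs ! i)"
  by (intro recursive_onI recursive.proj)

lemma recursive_on_comp:
  assumes "recursive_on (length gs) f" and "\<forall>g\<in>set gs. recursive_on n g"
  shows "recursive_on n (\<lambda>xs. f (map (\<lambda>g. g xs) gs))"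
proof -
  obtain f' where f': "recursive (length gs) f'" "\<And>xs. length xs = length gs \<Longrightarrow> f xs = f' xs"
    using assms(1) by (auto simp: recursive_on_def)
  obtain h where h: "\<forall>g\<in>set gs. recursive n (h g) \<and> (\<forall>xs. length xs = n \<longrightarrow> g xs = h g xs)"
    using assms(2) unfolding recursive_on_def by metis
  have "recursive n (\<lambda>xs. f' (map (\<lambda>g. g xs) (map h gs)))"
    by (rule recursive.comp) (use f' h in auto)
  moreover have "f (map (\<lambda>g. g xs) gs) = f' (map (\<lambda>g. g xs) (map h gs))" if "length xs = n" for xs
  proof -
    have "f (map (\<lambda>g. g xs) gs) = f' (map (\<lambda>g. g xs) gs)"
      by (rule f'(2)) simp
    moreover have "map (\<lambda>g. g xs) gs = map (\<lambda>g. g xs) (map h gs)"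
      using h that by simp
    ultimately show ?thesis by (simp only:)
  qed
  ultimately show ?thesis unfolding recursive_on_def by blast
qed

text \<open>The scheme \<open>prec\<close> recurses on its first argument. Composing it with
  \<open>m\<close> and all \<open>n\<close> projections lets the number of steps be computed while
  the step still sees every parameter.\<close>

lemma recursive_on_rec_nat:
  assumes "recursive_on n a" and "recursive_on (Suc (Suc n)) g" and "recursive_on n m"
  shows "recursive_on n (\<lambda>xs. rec_nat (a xs) (\<lambda>k v. g (k # v # xs)) (m xs))"
proof -
  obtain a' where a': "recursive n a'" "\<And>xs. length xs = n \<Longrightarrow> a xs = a' xs"
    using assms(1) by (auto simp: recursive_on_def)
  obtain g' where g': "recursive (Suc (Suc n)) g'" "\<And>xs. length xs = Suc (Suc n) \<Longrightarrow> g xs = g' xs"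
    using assms(2) by (auto simp: recursive_on_def)
  let ?gs = "m # map (\<lambda>i xs. xs ! i) [0..<n]"
  let ?F = "\<lambda>xs. rec_nat (a' (tl xs)) (\<lambda>k v. g' (k # v # tl xs)) (hd xs)"
  have "recursive_on (length ?gs) ?F"
    using recursive_onI[OF recursive.prec[OF a'(1) g'(1)]] by simp
  then have "recursive_on n (\<lambda>xs. ?F (map (\<lambda>g. g xs) ?gs))"
    by (rule recursive_on_comp) (auto intro: assms recursive_on_proj)
  then show ?thesis
  proof (rule recursive_on_cong)
    fix xs :: "nat list" assume len: "length xs = n"
    have "map (\<lambda>g. g xs) (map (\<lambda>i xs. xs ! i) [0..<n]) = xs"
      using map_nth[of xs] len by (simp add: o_def)
    then show "?F (map (\<lambda>g. g xs) ?gs) = rec_nat (a xs) (\<lambda>k v. g (k # v # xs)) (m xs)"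
      using len a' g' by simp
  qed
qed

lemma recursive_on_Least:
  assumes "recursive_on (Suc n) f" and "\<And>xs. length xs = n \<Longrightarrow> \<exists>y. f (y # xs) = 0"
  shows "recursive_on n (\<lambda>xs. LEAST y. f (y # xs) = 0)"
proof -
  obtain f' where f': "recursive (Suc n) f'" "\<And>xs. length xs = Suc n \<Longrightarrow> f xs = f' xs"
    using assms(1) by (auto simp: recursive_on_def)
  have "recursive n (\<lambda>xs. LEAST y. f' (y # xs) = 0)"
    by (rule recursive.mini) (use f' assms(2) in auto)
  then show ?thesis
    by (rule recursive_on_cong[OF recursive_onI]) (simp add: f'(2))
qed

lemma recursive_on_Suc:
  assumes "recursive_on n f"
  shows "recursive_on n (\<lambda>xs. Suc (f xs))"
  using recursive_on_comp[of "[f]" "\<lambda>xs. Suc (xs ! 0)" n] assms recursive_onI[OF recursive.succ]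
  by simp

lemma recursive_on_const: "recursive_on n (\<lambda>xs. c)"
proof (induction c)
  case 0
  show ?case by (intro recursive_onI recursive.zero)
next
  case (Suc c)
  then show ?case by (rule recursive_on_Suc)
qed

lemma recursive_on_add:
  assumes "recursive_on n f" and "recursive_on n g"
  shows "recursive_on n (\<lambda>xs. f xs + g xs)"
proof -
  have "recursive_on n (\<lambda>xs. rec_nat (f xs) (\<lambda>k v. Suc ((k # v # xs) ! 1)) (g xs))"
    by (intro recursive_on_rec_nat assms recursive_on_Suc recursive_on_proj) simp
  moreover have "rec_nat a (\<lambda>k v. Suc v) b = a + b" for a b :: nat
    by (induction b) auto
  ultimately show ?thesis by simp
qed

lemma recursive_on_diff:
  assumes "recursive_on n f" and "recursive_on n g"
  shows "recursive_on n (\<lambda>xs. f xs - g xs)"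
proof -
  have pred: "recursive_on m (\<lambda>xs. h xs - 1)" if "recursive_on m h" for m h
  proof -
    \<comment> \<open>The step ignores the accumulator and returns its index, so the result is the
      predecessor, with value 0 at 0.\<close>
    have "recursive_on m (\<lambda>xs. rec_nat 0 (\<lambda>k v. (k # v # xs) ! 0) (h xs))"
      by (intro recursive_on_rec_nat that recursive_on_const recursive_on_proj) simp
    moreover have "rec_nat 0 (\<lambda>k v. k) b = b - 1" for b :: nat
      by (cases b) auto
    ultimately show ?thesis by simp
  qed
  have "recursive_on n (\<lambda>xs. rec_nat (f xs) (\<lambda>k v. (k # v # xs) ! 1 - 1) (g xs))"
    by (intro recursive_on_rec_nat assms pred recursive_on_proj) simp
  moreover have "rec_nat a (\<lambda>k v. v - 1) b = a - b" for a b :: nat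
    by (induction b) auto
  ultimately show ?thesis by simp
qed

lemma recursive_on_triangle:
  assumes "recursive_on n f"
  shows "recursive_on n (\<lambda>xs. triangle (f xs))"
proof -
  have "recursive_on n (\<lambda>xs. rec_nat 0 (\<lambda>k v. (k # v # xs) ! 1 + Suc ((k # v # xs) ! 0)) (f xs))"
    by (intro recursive_on_rec_nat assms recursive_on_const recursive_on_add recursive_on_Suc
        recursive_on_proj) auto
  moreover have "rec_nat 0 (\<lambda>k v. v + Suc k) b = triangle b" for b :: nat
    by (induction b) auto
  ultimately show ?thesis by simp
qed

lemma recursive_on_prod_encode:
  assumes "recursive_on n f" and "recursive_on n g"
  shows "recursive_on n (\<lambda>xs. prod_encode (f xs, g xs))"
  unfolding prod_encode_def prod.case
  by (intro recursive_on_add recursive_on_triangle assms)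

section \<open>Unary computable functions and the pairing function\<close>

lemma computable_iff_recursive_on: "computable f \<longleftrightarrow> recursive_on 1 (\<lambda>xs. f (xs ! 0))"
proof -
  have "(\<forall>x. f x = g [x]) \<longleftrightarrow> (\<forall>xs. length xs = 1 \<longrightarrow> f (xs ! 0) = g xs)" for g
    by (auto simp: length_Suc_conv)
  then show ?thesis unfolding computable_def recursive_on_def by simp
qed

lemma recursive_on_computable:
  assumes "computable f" and "recursive_on n g"
  shows "recursive_on n (\<lambda>xs. f (g xs))"
  using recursive_on_comp[of "[g]" "\<lambda>xs. f (xs ! 0)" n] assms
  by (simp add: computable_iff_recursive_on)

lemma computable_comp: "computable f \<Longrightarrow> computable g \<Longrightarrow> computable (\<lambda>x. f (g x))"
  using recursive_on_computable[of f 1] by (simp add: computable_iff_recursive_on)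

lemma computable_id: "computable (\<lambda>x. x)"
  by (simp add: computable_iff_recursive_on recursive_on_proj)

lemma computable_const: "computable (\<lambda>x. c)"
  by (simp add: computable_iff_recursive_on recursive_on_const)

lemma computable_Suc: "computable Suc"
  unfolding computable_iff_recursive_on by (intro recursive_on_Suc recursive_on_proj) simp

lemma computable_add: "computable f \<Longrightarrow> computable g \<Longrightarrow> computable (\<lambda>x. f x + g x)"
  unfolding computable_iff_recursive_on by (rule recursive_on_add)

lemma computable_diff: "computable f \<Longrightarrow> computable g \<Longrightarrow> computable (\<lambda>x. f x - g x)"
  unfolding computable_iff_recursive_on by (rule recursive_on_diff)

lemma computable_prod_encode:
  "computable f \<Longrightarrow> computable g \<Longrightarrow> computable (\<lambda>x. prod_encode (f x, g x))"
  unfolding computable_iff_recursive_on by (rule recursive_on_prod_encode)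

text \<open>Packing parameter, index and accumulator into one number keeps the step unary, as coded
  types will require.\<close>

lemma computable_rec_nat:
  assumes "computable a" and "computable g" and "computable m"
  shows "computable (\<lambda>x. rec_nat (a x) (\<lambda>k v. g (prod_encode (x, prod_encode (k, v)))) (m x))"
proof -
  have "recursive_on 1 (\<lambda>xs. rec_nat (a (xs ! 0))
    (\<lambda>k v. g (prod_encode ((k # v # xs) ! 2, prod_encode ((k # v # xs) ! 0, (k # v # xs) ! 1))))
    (m (xs ! 0)))"
    by (intro recursive_on_rec_nat recursive_on_computable[OF assms(1)]
        recursive_on_computable[OF assms(2)] recursive_on_computable[OF assms(3)]
        recursive_on_prod_encode recursive_on_proj) auto
  then show ?thesis by (simp add: computable_iff_recursive_on numeral_2_eq_2)
qed

text \<open>The sum of the components of \<open>prod_decode z\<close> is the least \<open>s\<close> with \<open>z < triangle (Suc s)\<close>.\<close>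

lemma computable_prod_decode:
  "computable (\<lambda>z. fst (prod_decode z))" "computable (\<lambda>z. snd (prod_decode z))"
proof -
  \<comment> \<open>Truncated subtraction turns the strict inequality into an equation with 0, the
    form that minimization searches for.\<close>
  define s where "s z = (LEAST s. Suc z - triangle (Suc s) = 0)" for z
  have s_eq: "s z = m + n" if z: "z = prod_encode (m, n)" for z m n
    unfolding s_def
  proof (rule Least_equality)
    show "Suc z - triangle (Suc (m + n)) = 0"
      by (simp add: z prod_encode_def)
    fix y assume "Suc z - triangle (Suc y) = 0"
    then have "triangle (m + n) < triangle (Suc y)"
      by (simp add: z prod_encode_def)
    moreover have "triangle i \<le> triangle j" if "i \<le> j" for i j
      unfolding triangle_def using that by (intro div_le_mono mult_le_mono) auto
    ultimately show "m + n \<le> y"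
      by (metis not_less not_less_eq_eq)
  qed
  have "recursive_on 1 (\<lambda>xs. LEAST y. Suc ((y # xs) ! 1) - triangle (Suc ((y # xs) ! 0)) = 0)"
  proof (rule recursive_on_Least)
    show "recursive_on (Suc 1) (\<lambda>ys. Suc (ys ! 1) - triangle (Suc (ys ! 0)))"
      by (intro recursive_on_diff recursive_on_triangle recursive_on_Suc recursive_on_proj) auto
    show "\<exists>y. Suc ((y # xs) ! 1) - triangle (Suc ((y # xs) ! 0)) = 0" for xs
      \<comment> \<open>The search is bounded by \<open>z\<close> itself, because
        \<open>triangle (Suc z)\<close> is at least \<open>Suc z\<close>.\<close>
      by (rule exI[of _ "xs ! 0"]) simp
  qed
  then have s: "computable s"
    by (simp add: computable_iff_recursive_on s_def)
  have tri: "computable (\<lambda>z. triangle (s z))"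
    using s unfolding computable_iff_recursive_on by (rule recursive_on_triangle)
  have fst_eq: "fst (prod_decode z) = z - triangle (s z)"
    and snd_eq: "snd (prod_decode z) = s z - fst (prod_decode z)" for z
  proof -
    obtain m n where mn: "prod_decode z = (m, n)" by fastforce
    then have z: "z = prod_encode (m, n)" by (metis prod_decode_inverse)
    show "fst (prod_decode z) = z - triangle (s z)"
      "snd (prod_decode z) = s z - fst (prod_decode z)"
      using s_eq[OF z] by (simp_all add: mn) (simp add: z prod_encode_def)
  qed
  show fst: "computable (\<lambda>z. fst (prod_decode z))"
    unfolding fst_eq by (intro computable_diff computable_id tri)
  show "computable (\<lambda>z. snd (prod_decode z))"
    unfolding snd_eq by (intro computable_diff s fst)
qed

section \<open>Effective maps between encoded types\<close>

text \<open>Letting the type determine the code allows statements about nested lists and pairs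
  without naming codes. Injectivity makes equality of values decidable from their codes.\<close>

class encodable =
  fixes enc :: "'a \<Rightarrow> nat"
  assumes enc_eq_iff: "enc x = enc y \<longleftrightarrow> x = y"

instantiation nat :: encodable
begin
definition enc_nat :: "nat \<Rightarrow> nat" where [simp]: "enc_nat n = n"
instance by standard simp
end

instantiation bool :: encodable
begin
definition enc_bool :: "bool \<Rightarrow> nat" where [simp]: "enc_bool b = of_bool b"
instance by standard simp
end

instantiation prod :: (encodable, encodable) encodable
begin
definition enc_prod :: "'a \<times> 'b \<Rightarrow> nat" where
  [simp]: "enc_prod p = prod_encode (enc (fst p), enc (snd p))"
instance by standard (auto simp: enc_eq_iff prod_eq_iff)
end

instantiation list :: (encodable) encodable
begin
definition enc_list :: "'a list \<Rightarrow> nat" where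
  [simp]: "enc_list xs = list_encode (map enc xs)"
instance
proof
  have "inj (enc :: 'a \<Rightarrow> nat)" by (simp add: inj_def enc_eq_iff)
  then show "enc xs = enc ys \<longleftrightarrow> xs = ys" for xs ys :: "'a list"
    by (simp add: list_encode_eq)
qed
end

definition effective :: "('a::encodable \<Rightarrow> 'b::encodable) \<Rightarrow> bool" where
  "effective f \<longleftrightarrow> (\<exists>g. computable g \<and> (\<forall>x. g (enc x) = enc (f x)))"

lemma effectiveI: "computable g \<Longrightarrow> (\<And>x. g (enc x) = enc (f x)) \<Longrightarrow> effective f"
  by (auto simp: effective_def)

text \<open>The closure rules take arguments that depend on a common context \<open>x\<close>, so
  that \<open>intro effective\<close> can take a term apart symbol by symbol.\<close>

named_theorems effective

lemma effective_const [effective]: "effective (\<lambda>x. c)"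
  by (rule effectiveI[OF computable_const[of "enc c"]]) simp

lemma effective_id [effective]: "effective (\<lambda>x. x)"
  by (rule effectiveI[OF computable_id]) simp

lemma effective_comp:
  assumes "effective f" and "effective g"
  shows "effective (\<lambda>x. f (g x))"
proof -
  obtain f' where f': "computable f'" "\<And>x. f' (enc x) = enc (f x)"
    using assms(1) unfolding effective_def by blast
  obtain g' where g': "computable g'" "\<And>x. g' (enc x) = enc (g x)"
    using assms(2) unfolding effective_def by blast
  show ?thesis
    by (rule effectiveI[OF computable_comp[OF f'(1) g'(1)]]) (simp add: f' g')
qed

lemma effective_Pair [effective]:
  assumes "effective f" and "effective g"
  shows "effective (\<lambda>x. (f x, g x))"
proof -
  obtain f' where f': "computable f'" "\<And>x. f' (enc x) = enc (f x)"
    using assms(1) unfolding effective_def by blast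
  obtain g' where g': "computable g'" "\<And>x. g' (enc x) = enc (g x)"
    using assms(2) unfolding effective_def by blast
  show ?thesis
    by (rule effectiveI[OF computable_prod_encode[OF f'(1) g'(1)]]) (simp add: f' g')
qed

lemma effective_fst [effective]: "effective f \<Longrightarrow> effective (\<lambda>x. fst (f x))"
  by (rule effective_comp[OF effectiveI[OF computable_prod_decode(1)]]) simp

lemma effective_snd [effective]: "effective f \<Longrightarrow> effective (\<lambda>x. snd (f x))"
  by (rule effective_comp[OF effectiveI[OF computable_prod_decode(2)]]) simp

lemma effective_Suc [effective]: "effective f \<Longrightarrow> effective (\<lambda>x. Suc (f x))"
  by (rule effective_comp[OF effectiveI[OF computable_Suc]]) simp

lemma effective_rec_nat [effective]:
  assumes "effective a" and "effective (\<lambda>p. g (fst p) (fst (snd p)) (snd (snd p)))" and "effective m"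
  shows "effective (\<lambda>x. rec_nat (a x) (g x) (m x))"
proof -
  obtain a' where a': "computable a'" "\<And>x. a' (enc x) = enc (a x)"
    using assms(1) unfolding effective_def by blast
  obtain g' where g': "computable g'"
    "\<And>p. g' (enc p) = enc (g (fst p) (fst (snd p)) (snd (snd p)))"
    using assms(2) unfolding effective_def by blast
  obtain m' where m': "computable m'" "\<And>x. m' (enc x) = enc (m x)"
    using assms(3) unfolding effective_def by blast
  have "rec_nat (enc (a x)) (\<lambda>k v. g' (prod_encode (enc x, prod_encode (k, v)))) n
      = enc (rec_nat (a x) (g x) n)" for x n
  proof (induction n)
    case (Suc n)
    then show ?case using g'(2)[of "(x, n, rec_nat (a x) (g x) n)"] by simp
  qed simp
  then show ?thesis
    by (intro effectiveI[OF computable_rec_nat[OF a'(1) g'(1) m'(1)]]) (simp add: a' m')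
qed

lemma effective_add [effective]:
  fixes f g :: "'a::encodable \<Rightarrow> nat"
  assumes "effective f" and "effective g"
  shows "effective (\<lambda>x. f x + g x)"
proof -
  have "effective (\<lambda>x. rec_nat (f x) (\<lambda>_. Suc) (g x))"
    by (intro effective assms)
  moreover have "rec_nat a (\<lambda>_. Suc) b = a + b" for a b
    by (induction b) auto
  ultimately show ?thesis by simp
qed

lemma effective_power_two [effective]:
  fixes g :: "'a::encodable \<Rightarrow> nat"
  assumes "effective g"
  shows "effective (\<lambda>x. 2 ^ g x :: nat)"
proof -
  have "effective (\<lambda>x. rec_nat 1 (\<lambda>_ v. v + v :: nat) (g x))"
    by (intro effective assms)
  moreover have "rec_nat 1 (\<lambda>_ v. v + v) b = (2 ^ b :: nat)" for b
    by (induction b) auto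
  ultimately show ?thesis by simp
qed

text \<open>A case distinction is a recursion of at most one step: it starts from the else branch,
  and the step overwrites it with the other branch.\<close>

lemma effective_If [effective]:
  assumes "effective b" and "effective f" and "effective g"
  shows "effective (\<lambda>x. if b x then f x else g x)"
proof -
  have "effective (\<lambda>x. of_bool (b x) :: nat)"
    using assms(1) unfolding effective_def by simp
  then have "effective (\<lambda>x. rec_nat (g x) (\<lambda>_ _. f x) (of_bool (b x)))"
    by (intro effective assms effective_comp[OF assms(2)])
  moreover have "rec_nat (g x) (\<lambda>_ _. f x) (of_bool (b x)) = (if b x then f x else g x)" for x
    by simp
  ultimately show ?thesis by simp
qed

text \<open>By injectivity of \<open>enc\<close> it is enough to compare codes, and the two
  truncated differences add up to 0 exactly when the codes agree.\<close>

lemma effective_eq [effective]: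
  assumes "effective f" and "effective g"
  shows "effective (\<lambda>x. f x = g x)"
proof -
  obtain f' where f': "computable f'" "\<And>x. f' (enc x) = enc (f x)"
    using assms(1) unfolding effective_def by blast
  obtain g' where g': "computable g'" "\<And>x. g' (enc x) = enc (g x)"
    using assms(2) unfolding effective_def by blast
  have "computable (\<lambda>x. 1 - ((f' x - g' x) + (g' x - f' x)))"
    by (intro computable_diff computable_add computable_const f' g')
  then show ?thesis
  proof (rule effectiveI)
    show "1 - ((f' (enc x) - g' (enc x)) + (g' (enc x) - f' (enc x))) = enc (f x = g x)" for x
      using enc_eq_iff[of "f x" "g x"] by (cases "f x = g x") (auto simp: f' g')
  qed
qed

lemma effective_enc [effective]: "effective f \<Longrightarrow> effective (\<lambda>x. enc (f x))"
  by (rule effective_comp[OF effectiveI[OF computable_id]]) simp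

lemma effective_Cons [effective]:
  assumes "effective f" and "effective g"
  shows "effective (\<lambda>x. f x # g x)"
proof -
  have "effective (\<lambda>x. Suc (enc (f x, g x)))"
    by (intro effective assms)
  then show ?thesis unfolding effective_def by simp
qed

lemma computable_iff_effective: "computable f \<longleftrightarrow> effective f"
proof -
  have "computable f" if "computable g" "\<forall>x. g x = f x" for g
    using that by (metis ext)
  then show ?thesis by (auto simp: effective_def)
qed

lemma effective_not [effective]:
  assumes "effective f"
  shows "effective (\<lambda>x. \<not> f x)"
proof -
  have "effective (\<lambda>x. if f x then False else True)"
    by (intro effective assms)
  moreover have "(\<lambda>x. if f x then False else True) = (\<lambda>x. \<not> f x)"
    by auto
  ultimately show ?thesis by (simp only:)
qed

lemma effective_prod_decode [effective]:
  "effective f \<Longrightarrow> effective (\<lambda>x. prod_decode (f x))"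
  by (rule effective_comp[OF effectiveI[OF computable_id]]) simp

lemma effective_diff [effective]:
  fixes f g :: "'a::encodable \<Rightarrow> nat"
  assumes "effective f" and "effective g"
  shows "effective (\<lambda>x. f x - g x)"
proof -
  have "effective (\<lambda>x. rec_nat (f x) (\<lambda>_ v. rec_nat 0 (\<lambda>k _. k) v) (g x))"
    by (intro effective assms)
  moreover have "rec_nat 0 (\<lambda>k _. k) v = v - 1" for v :: nat
    by (cases v) auto
  moreover have "rec_nat a (\<lambda>_ v. v - 1) b = a - b" for a b :: nat
    by (induction b) auto
  ultimately show ?thesis by simp
qed

section \<open>Effective list operations\<close>

lemma effective_tl [effective]:
  assumes "effective (f :: _ \<Rightarrow> 'b::encodable list)"
  shows "effective (\<lambda>x. tl (f x))"
proof -
  have "computable (\<lambda>n. snd (prod_decode (n - 1)))"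
    unfolding computable_iff_effective by (intro effective)
  then have "effective (tl :: 'b list \<Rightarrow> _)"
  proof (rule effectiveI)
    show "snd (prod_decode (enc xs - 1)) = enc (tl xs)" for xs :: "'b list"
      \<comment> \<open>The code 0 of the empty list survives the predecessor and decodes to a pair
        of zeros, whose second component is the code of \<open>tl [] = []\<close>.\<close>
      using prod_decode_triangle_add[of 0 0]
      by (cases xs) (auto simp: prod_decode_aux.simps[of 0])
  qed
  then show ?thesis using assms by (rule effective_comp)
qed

lemma effective_hd [effective]:
  assumes "effective (f :: _ \<Rightarrow> 'b::encodable list)"
  shows "effective (\<lambda>x. hd (f x))"
proof -
  \<comment> \<open>\<open>hd []\<close> is unspecified but fixed, so its code is a legitimate
    constant.\<close>
  let ?c = "enc (hd [] :: 'b)"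
  have "computable (\<lambda>n. if n = 0 then ?c else fst (prod_decode (n - 1)))"
    unfolding computable_iff_effective by (intro effective)
  then have "effective (hd :: 'b list \<Rightarrow> _)"
  proof (rule effectiveI)
    show "(if enc xs = 0 then ?c else fst (prod_decode (enc xs - 1))) = enc (hd xs)" for xs :: "'b list"
      by (cases xs) auto
  qed
  then show ?thesis using assms by (rule effective_comp)
qed

lemma length_le_enc: "length xs \<le> enc xs"
proof (induction xs)
  case (Cons x xs)
  then show ?case using le_prod_encode_2[of "enc xs" "enc x"] by simp
qed simp

text \<open>The code of a list bounds its length, hence the number of steps of the iteration.\<close>

lemma effective_foldl [effective]:
  fixes l :: "'a::encodable \<Rightarrow> 'b::encodable list" and a :: "'a \<Rightarrow> 'c::encodable"
  assumes "effective (\<lambda>p. f (fst p) (fst (snd p)) (snd (snd p)))" and "effective a" and "effective l"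
  shows "effective (\<lambda>x. foldl (f x) (a x) (l x))"
proof -
  \<comment> \<open>The premise speaks of packed triples; this form accepts arguments depending on
    any context and so works with \<open>intro\<close>.\<close>
  have f: "effective (\<lambda>x. f (g x) (h x) (k x))" if "effective g" "effective h" "effective k"
    for g :: "'d::encodable \<Rightarrow> _" and h k
    using effective_comp[OF assms(1) effective_Pair[OF that(1) effective_Pair[OF that(2,3)]]] by simp
  \<comment> \<open>The state holds the unread rest and the accumulator. On an empty rest the step
    idles, so surplus steps are harmless.\<close>
  define step where
    "step x s = (if fst s = [] then s else (tl (fst s), f x (snd s) (hd (fst s))))" for x s
  have step: "rec_nat (xs, v) (\<lambda>_. step x) n = (drop n xs, foldl (f x) v (take n xs))" for x n xs v
  proof (induction n)
    case (Suc n)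
    then show ?case
      by (cases "n < length xs")
        (auto simp: step_def take_Suc_conv_app_nth hd_drop_conv_nth drop_Suc tl_drop)
  qed simp
  have "effective (\<lambda>x. snd (rec_nat (l x, a x) (\<lambda>_ s. step x s) (enc (l x))))"
    unfolding step_def by (intro effective assms f)
  then show ?thesis by (simp add: step length_le_enc del: enc_list_def)
qed

lemma effective_rev [effective]: "effective f \<Longrightarrow> effective (\<lambda>x. rev (f x))"
proof -
  assume "effective f"
  then have "effective (\<lambda>x. foldl (\<lambda>ys y. y # ys) [] (f x))"
    by (intro effective)
  then show ?thesis by (simp add: foldl_conv_fold rev_conv_fold cong: fold_cong)
qed

lemma effective_foldr [effective]:
  fixes l :: "'a::encodable \<Rightarrow> 'b::encodable list" and a :: "'a \<Rightarrow> 'c::encodable"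
  assumes "effective (\<lambda>p. f (fst p) (fst (snd p)) (snd (snd p)))" and "effective l" and "effective a"
  shows "effective (\<lambda>x. foldr (f x) (l x) (a x))"
proof -
  have f: "effective (\<lambda>x. f (g x) (h x) (k x))" if "effective g" "effective h" "effective k"
    for g :: "'d::encodable \<Rightarrow> _" and h k
    using effective_comp[OF assms(1) effective_Pair[OF that(1) effective_Pair[OF that(2,3)]]] by simp
  show ?thesis unfolding foldr_conv_foldl by (intro effective assms f)
qed

lemma effective_append [effective]:
  fixes f g :: "'a::encodable \<Rightarrow> 'b::encodable list"
  assumes "effective f" and "effective g"
  shows "effective (\<lambda>x. f x @ g x)"
proof -
  have "effective (\<lambda>x. foldr (\<lambda>y ys. y # ys) (f x) (g x))"
    by (intro effective assms)
  moreover have "foldr (\<lambda>y ys. y # ys) xs ys = xs @ ys" for xs ys :: "'b list"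
    by (induction xs) auto
  ultimately show ?thesis by simp
qed

lemma effective_map [effective]:
  fixes l :: "'a::encodable \<Rightarrow> 'b::encodable list" and f :: "'a \<Rightarrow> 'b \<Rightarrow> 'c::encodable"
  assumes "effective (\<lambda>p. f (fst p) (snd p))" and "effective l"
  shows "effective (\<lambda>x. map (f x) (l x))"
proof -
  have f: "effective (\<lambda>x. f (g x) (h x))" if "effective g" "effective h"
    for g :: "'d::encodable \<Rightarrow> _" and h
    using effective_comp[OF assms(1) effective_Pair[OF that]] by simp
  have "effective (\<lambda>x. foldr (\<lambda>y ys. f x y # ys) (l x) [])"
    by (intro effective assms f)
  moreover have "foldr (\<lambda>y ys. f x y # ys) xs [] = map (f x) xs" for x xs
    by (induction xs) auto
  ultimately show ?thesis by simp
qed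

lemma effective_filter [effective]:
  fixes l :: "'a::encodable \<Rightarrow> 'b::encodable list"
  assumes "effective (\<lambda>p. P (fst p) (snd p))" and "effective l"
  shows "effective (\<lambda>x. filter (P x) (l x))"
proof -
  have P: "effective (\<lambda>x. P (g x) (h x))" if "effective g" "effective h"
    for g :: "'d::encodable \<Rightarrow> _" and h
    using effective_comp[OF assms(1) effective_Pair[OF that]] by simp
  have "effective (\<lambda>x. foldr (\<lambda>y ys. if P x y then y # ys else ys) (l x) [])"
    by (intro effective assms P)
  moreover have "foldr (\<lambda>y ys. if P x y then y # ys else ys) xs [] = filter (P x) xs" for x xs
    by (induction xs) auto
  ultimately show ?thesis by simp
qed

lemma effective_concat [effective]:
  fixes f :: "'a::encodable \<Rightarrow> 'b::encodable list list"
  assumes "effective f"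
  shows "effective (\<lambda>x. concat (f x))"
proof -
  have "effective (\<lambda>x. foldr (\<lambda>xs ys. xs @ ys) (f x) [])"
    by (intro effective assms)
  moreover have "foldr (\<lambda>xs ys. xs @ ys) xss [] = concat xss" for xss :: "'b list list"
    by (induction xss) auto
  ultimately show ?thesis by simp
qed

lemma effective_member [effective]:
  assumes "effective f" and "effective l"
  shows "effective (\<lambda>x. f x \<in> set (l x))"
proof -
  have "effective (\<lambda>x. filter (\<lambda>y. y = f x) (l x) \<noteq> [])"
    by (intro effective assms effective_comp[OF assms(1)])
  then show ?thesis by (simp add: filter_empty_conv)
qed

lemma effective_remdups [effective]:
  fixes f :: "'a::encodable \<Rightarrow> 'b::encodable list"
  assumes "effective f"
  shows "effective (\<lambda>x. remdups (f x))"
proof -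
  have "effective (\<lambda>x. foldr (\<lambda>y ys. if y \<in> set ys then ys else y # ys) (f x) [])"
    by (intro effective assms)
  moreover have "foldr (\<lambda>y ys. if y \<in> set ys then ys else y # ys) xs [] = remdups xs" for xs :: "'b list"
    by (induction xs) auto
  ultimately show ?thesis by simp
qed

lemma effective_length [effective]:
  fixes f :: "'a::encodable \<Rightarrow> 'b::encodable list"
  assumes "effective f"
  shows "effective (\<lambda>x. length (f x))"
proof -
  have "effective (\<lambda>x. foldr (\<lambda>_ n. Suc n) (f x) 0)"
    by (intro effective assms)
  moreover have "foldr (\<lambda>_ n. Suc n) xs 0 = length xs" for xs :: "'b list"
    by (induction xs) auto
  ultimately show ?thesis by simp
qed

lemma effective_sum_list [effective]:
  fixes f :: "_ \<Rightarrow> nat list"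
  assumes "effective f"
  shows "effective (\<lambda>x. sum_list (f x))"
proof -
  have "effective (\<lambda>x. foldr (\<lambda>n s. n + s) (f x) 0)"
    by (intro effective assms)
  moreover have "foldr (\<lambda>n s. n + s) xs 0 = sum_list xs" for xs :: "nat list"
    by (induction xs) auto
  ultimately show ?thesis by simp
qed

lemma effective_set_encode [effective]:
  assumes "effective f"
  shows "effective (\<lambda>x. set_encode (set (f x)))"
proof -
  \<comment> \<open>\<open>set_encode\<close> sums powers of two over a set, so repeated entries
    have to be dropped to be counted once.\<close>
  have "effective (\<lambda>x. sum_list (map (\<lambda>n. 2 ^ n :: nat) (remdups (f x))))"
    by (intro effective assms)
  then show ?thesis
    by (simp add: set_encode_def sum_list_distinct_conv_sum_set)
qed

lemma effective_upt [effective]: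
  assumes "effective f"
  shows "effective (\<lambda>x. [0..<f x])"
proof -
  have "effective (\<lambda>x. rec_nat [] (\<lambda>k ks. ks @ [k]) (f x))"
    by (intro effective assms)
  moreover have "rec_nat [] (\<lambda>k ks. ks @ [k]) n = [0..<n]" for n
    by (induction n) auto
  ultimately show ?thesis by simp
qed

lemma effective_replicate [effective]:
  fixes g :: "'a::encodable \<Rightarrow> 'b::encodable"
  assumes "effective f" and "effective g"
  shows "effective (\<lambda>x. replicate (f x) (g x))"
proof -
  have "effective (\<lambda>x. rec_nat [] (\<lambda>_ ys. g x # ys) (f x))"
    by (intro effective assms effective_comp[OF assms(2)])
  moreover have "rec_nat [] (\<lambda>_ ys. y # ys) n = replicate n y" for n and y :: 'b
    by (induction n) auto
  ultimately show ?thesis by simp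
qed

lemma effective_drop [effective]:
  fixes g :: "'a::encodable \<Rightarrow> 'b::encodable list"
  assumes "effective f" and "effective g"
  shows "effective (\<lambda>x. drop (f x) (g x))"
proof -
  have "effective (\<lambda>x. rec_nat (g x) (\<lambda>_ ys. tl ys) (f x))"
    by (intro effective assms)
  moreover have "rec_nat ys (\<lambda>_ ys. tl ys) n = drop n ys" for n and ys :: "'b list"
    by (induction n) (auto simp: drop_Suc tl_drop)
  ultimately show ?thesis by simp
qed

lemma effective_zip [effective]:
  fixes f :: "'a::encodable \<Rightarrow> 'b::encodable list" and g :: "'a \<Rightarrow> 'c::encodable list"
  assumes "effective f" and "effective g"
  shows "effective (\<lambda>x. zip (f x) (g x))"
proof -
  \<comment> \<open>The fold runs over the first list; the state carries the unread part of the
    second list and the pairs made so far.\<close>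
  define step where "step s x = (if fst s = [] then s else (tl (fst s), snd s @ [(x, hd (fst s))]))"
    for s :: "'c list \<times> ('b \<times> 'c) list" and x
  have "effective (\<lambda>x. snd (foldl (\<lambda>s y. step s y) (g x, []) (f x)))"
    unfolding step_def by (intro effective assms)
  moreover have "snd (foldl (\<lambda>s y. step s y) (ys, zs) xs) = zs @ zip xs ys" for xs ys zs
  proof (induction xs arbitrary: ys zs)
    case (Cons x xs)
    then show ?case by (cases ys) (auto simp: step_def)
  qed simp
  ultimately show ?thesis by simp
qed

lemma effective_product_lists [effective]:
  fixes f :: "'a::encodable \<Rightarrow> 'b::encodable list list"
  assumes "effective f"
  shows "effective (\<lambda>x. product_lists (f x))"
proof -
  have "effective (\<lambda>x. foldr (\<lambda>xs xss. concat (map (\<lambda>y. map (\<lambda>ys. y # ys) xss) xs)) (f x) [[]])"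
    by (intro effective assms)
  moreover have "foldr (\<lambda>xs xss. concat (map (\<lambda>y. map (\<lambda>ys. y # ys) xss) xs)) xss [[]] = product_lists xss"
    for xss :: "'b list list"
    by (induction xss) auto
  ultimately show ?thesis by simp
qed

text \<open>Absent keys have the value \<open>0\<close>.\<close>

definition lookup :: "('a \<times> nat) list \<Rightarrow> 'a \<Rightarrow> nat" where
  "lookup ps k = foldr (\<lambda>p v. if fst p = k then snd p else v) ps 0"

lemma lookup_eq: "map_of ps k = Some v \<Longrightarrow> lookup ps k = v"
  by (induction ps) (auto simp: lookup_def split: if_splits)

lemma effective_lookup [effective]:
  assumes "effective f" and "effective g"
  shows "effective (\<lambda>x. lookup (f x) (g x))"
  unfolding lookup_def by (intro effective assms effective_comp[OF assms(2)])

section \<open>Block maps\<close>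

lemma set_product_lists_replicate:
  "set (product_lists (replicate k xs)) = {ys. length ys = k \<and> set ys \<subseteq> set xs}"
  by (auto simp: product_lists_set list_all2_conv_all_nth subset_code(1) all_set_conv_all_nth)

lemma ball_words_Suc:
  "ball_words G (Suc r) =
     ball_words G r @ product_lists (replicate (Suc r) (sorted_list_of_set G))"
  by (simp add: ball_words_def)

lemma set_ball_words:
  assumes "finite G"
  shows "set (ball_words G r) = {w \<in> lists G. length w \<le> r}"
  using assms by (auto simp: ball_words_def set_product_lists_replicate)

lemma distinct_ball_words: "distinct (ball_words G r)"
proof (induction r)
  case 0
  show ?case by (simp add: ball_words_def)
next
  case (Suc r)
  have "length w \<le> r" if "w \<in> set (ball_words G r)" for w
    using that by (auto simp: ball_words_def dest: in_set_product_lists_length)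
  moreover have "distinct (product_lists (replicate (Suc r) (sorted_list_of_set G)))"
    by (intro distinct_product_lists) auto
  ultimately show ?case
    using Suc unfolding ball_words_Suc by (fastforce dest: in_set_product_lists_length)
qed

lemma set_local_patterns:
  "finite A \<Longrightarrow>
     set (local_patterns G A r) = {vs. length vs = length (ball_words G r) \<and> set vs \<subseteq> A}"
  by (simp add: local_patterns_def set_product_lists_replicate)

text \<open>Keeps the \<open>!\<close> in \<open>block_map_enum\<close> within range: every one of
  the \<open>Suc n\<close> radii has at least a constant table.\<close>

lemma length_block_map_candidates:
  assumes "finite A" and "A \<noteq> {}"
  shows "n < length (concat (map (\<lambda>r. map (Pair r) (block_tables G A r)) [0..<Suc n]))"
proof -
  obtain a where "a \<in> A" using assms(2) by blast
  then have "replicate (length (local_patterns G A r)) a \<in> set (block_tables G A r)" for r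
    using assms(1) by (auto simp: block_tables_def set_product_lists_replicate)
  then have "1 \<le> length (block_tables G A r)" for r
    by (metis One_nat_def Suc_leI length_pos_if_in_set)
  then have "(\<Sum>r\<leftarrow>[0..<Suc n]. 1) \<le> (\<Sum>r\<leftarrow>[0..<Suc n]. length (block_tables G A r))"
    by (intro sum_list_mono) auto
  then show ?thesis
    by (simp add: length_concat o_def sum_list_triv)
qed

text \<open>Ensures that zipping local patterns with the table truncates nothing, so that every
  local pattern is a key.\<close>

lemma length_block_table:
  assumes "finite A" and "A \<noteq> {}"
  shows "length (snd (block_map_enum G A n)) = length (local_patterns G A (block_radius G A n))"
proof -
  have "block_map_enum G A n \<in> set (concat (map (\<lambda>r. map (Pair r) (block_tables G A r)) [0..<Suc n]))"
    unfolding block_map_enum_def by (rule nth_mem[OF length_block_map_candidates[OF assms]])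
  then obtain r t where "block_map_enum G A n = (r, t)" "t \<in> set (block_tables G A r)"
    by (auto simp del: upt_Suc)
  then show ?thesis
    by (auto simp: block_radius_def block_tables_def dest: in_set_product_lists_length)
qed

text \<open>Every \<open>A\<close>-valued window is a key of the table, so the partial
  \<open>the (map_of ...)\<close> can give way to the total, effective
  \<open>lookup\<close>.\<close>

lemma block_map_eq_lookup:
  assumes "finite A" and "A \<noteq> {}"
    and "w \<in> set (ball_words G (block_radius G A n)) \<rightarrow>\<^sub>E A"
  shows "block_map G A n w =
    lookup (zip (local_patterns G A (block_radius G A n)) (snd (block_map_enum G A n)))
      (map w (ball_words G (block_radius G A n)))"
proof -
  let ?r = "block_radius G A n"
  have "map w (ball_words G ?r) \<in> set (local_patterns G A ?r)"
    using assms(1,3) by (auto simp: set_local_patterns)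
  then obtain v where v: "map_of (zip (local_patterns G A ?r) (snd (block_map_enum G A n)))
      (map w (ball_words G ?r)) = Some v"
    using length_block_table[OF assms(1,2), of G n] by (metis map_of_zip_is_Some)
  then show ?thesis
    using assms(3) by (simp add: block_map_def lookup_eq[OF v])
qed

text \<open>\<open>G\<close> is fixed beforehand, so its sorted list enters the computation as a
  constant; the same holds for \<open>A\<close> below.\<close>

lemma effective_ball_words [effective]:
  assumes "effective f"
  shows "effective (\<lambda>x. ball_words G (f x))"
  unfolding ball_words_def by (intro effective assms)

lemma effective_local_patterns [effective]:
  assumes "effective f"
  shows "effective (\<lambda>x. local_patterns G A (f x))"
  unfolding local_patterns_def by (intro effective assms)

lemma effective_block_tables [effective]:
  assumes "effective f"
  shows "effective (\<lambda>x. block_tables G A (f x))"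
  unfolding block_tables_def by (intro effective assms)

lemma effective_block_map_enum:
  assumes "finite A" and "A \<noteq> {}" and "effective f"
  shows "effective (\<lambda>x. block_map_enum G A (f x))"
proof -
  \<comment> \<open>\<open>hd\<close> after \<open>drop\<close> agrees with \<open>!\<close> for
    indices in range, which the length bound provides.\<close>
  have "effective (\<lambda>x. hd (drop (f x)
      (concat (map (\<lambda>r. map (\<lambda>t. (r, t)) (block_tables G A r)) [0..<Suc (f x)]))))"
    by (intro effective assms)
  then show ?thesis
    unfolding block_map_enum_def using length_block_map_candidates[OF assms(1,2)]
    by (simp add: hd_drop_conv_nth del: upt_Suc)
qed

text \<open>
  A configuration is represented by its values on the words in \<open>B\<close>. The computed values are junk at
  words so long that the window of the block map leaves \<open>B\<close>.
\<close>

definition apply_block ::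
  "nat set \<Rightarrow> nat set \<Rightarrow> nat list list \<Rightarrow> nat \<Rightarrow> (nat list \<times> nat) list \<Rightarrow> (nat list \<times> nat) list" where
  "apply_block G A B n ps =
     map (\<lambda>i. (i,
       lookup (zip (local_patterns G A (block_radius G A n)) (snd (block_map_enum G A n)))
         (map (\<lambda>j. lookup ps (i @ j)) (ball_words G (block_radius G A n))))) B"

definition apply_blocks ::
  "nat set \<Rightarrow> nat set \<Rightarrow> nat list list \<Rightarrow> nat list \<Rightarrow> (nat list \<times> nat) list \<Rightarrow> (nat list \<times> nat) list" where
  "apply_blocks G A B u ps = foldr (apply_block G A B) u ps"

definition total_radius :: "nat set \<Rightarrow> nat set \<Rightarrow> nat list \<Rightarrow> nat" where
  "total_radius G A u = sum_list (map (block_radius G A) u)"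

text \<open>The entry at the empty word is the value at the position from which the pattern is
  read.\<close>

definition separating_patterns ::
  "nat set \<Rightarrow> nat set \<Rightarrow> nat list list \<Rightarrow> nat list \<Rightarrow> nat list \<Rightarrow> nat list list \<Rightarrow> nat list list" where
  "separating_patterns G A B u v vss =
     filter (\<lambda>vs. lookup (apply_blocks G A B u (zip B vs)) [] \<noteq>
                  lookup (apply_blocks G A B v (zip B vs)) []) vss"

text \<open>The inner \<open>set_encode\<close> codes one pattern through its graph, as
  \<open>pattern_encode\<close> does; the outer one is the canonical index of the finite query
  set.\<close>

definition separating_code :: "nat set \<Rightarrow> nat set \<Rightarrow> nat list \<Rightarrow> nat list \<Rightarrow> nat" where
  "separating_code G A u v =
     set_encode (set (map (\<lambda>vs. set_encode (set (map enc
       (zip (ball_words G (total_radius G A (u @ v))) vs))))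
       (separating_patterns G A (ball_words G (total_radius G A (u @ v))) u v
         (local_patterns G A (total_radius G A (u @ v))))))"

lemma effective_separating_code:
  assumes A: "finite A" "A \<noteq> {}"
  shows "effective (\<lambda>p. separating_code G A (fst p) (snd p))"
proof -
  note [effective] = effective_block_map_enum[OF A]
  have [effective]: "effective (\<lambda>x. block_radius G A (f x))" if "effective f"
    for f :: "'a::encodable \<Rightarrow> nat"
    unfolding block_radius_def by (intro effective that)
  have [effective]: "effective (\<lambda>x. total_radius G A (f x))" if "effective f"
    for f :: "'a::encodable \<Rightarrow> nat list"
    unfolding total_radius_def by (intro effective that)
  have block: "effective (\<lambda>p. apply_block G A (fst p) (fst (snd p)) (snd (snd p)))"
    unfolding apply_block_def by (intro effective)
  have [effective]: "effective (\<lambda>x. apply_block G A (f x) (g x) (h x))"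
    if "effective f" "effective g" "effective h"
    for f :: "'a::encodable \<Rightarrow> nat list list" and g h
    using effective_comp[OF block effective_Pair[OF that(1) effective_Pair[OF that(2,3)]]] by simp
  have blocks: "effective (\<lambda>p. apply_blocks G A (fst p) (fst (snd p)) (snd (snd p)))"
    unfolding apply_blocks_def by (intro effective)
  have [effective]: "effective (\<lambda>x. apply_blocks G A (f x) (g x) (h x))"
    if "effective f" "effective g" "effective h"
    for f :: "'a::encodable \<Rightarrow> nat list list" and g h
    using effective_comp[OF blocks effective_Pair[OF that(1) effective_Pair[OF that(2,3)]]] by simp
  show ?thesis
    unfolding separating_code_def separating_patterns_def by (intro effective)
qed

section \<open>Separating patterns decide equality\<close>

lemma lookup_map: "k \<in> set ks \<Longrightarrow> lookup (map (\<lambda>k. (k, f k)) ks) k = f k"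
  by (intro lookup_eq) (simp add: map_of_map_restrict)

text \<open>With distinct keys \<open>map_of\<close> hides no pair, so the code of a pattern is
  computable directly from its association list.\<close>

lemma pattern_encode_map_of_zip:
  assumes "distinct ws" and "length vs = length ws"
  shows "pattern_encode (map_of (zip ws vs)) = set_encode (set (map enc (zip ws vs)))"
proof -
  have "map enc w = w" for w :: "nat list"
    by (induction w) auto
  then have "(\<lambda>(i, a). prod_encode (list_encode i, a)) = (enc :: nat list \<times> nat \<Rightarrow> nat)"
    by (auto simp: fun_eq_iff)
  moreover have "Map.graph (map_of (zip ws vs)) = set (zip ws vs)"
    using assms by (intro graph_map_of_if_distinct_dom) simp
  ultimately show ?thesis by (simp add: pattern_encode_def del: enc_prod_def)
qed

text \<open>Patterns have finite graphs, where \<open>set_encode\<close> is injective. Hence a code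
  lies in the image of the colanguage only if its own pattern lies in the colanguage.\<close>

lemma pattern_encode_eq_iff:
  assumes "v \<in> patterns G A" and "w \<in> patterns G A"
  shows "pattern_encode v = pattern_encode w \<longleftrightarrow> v = w"
proof
  assume eq: "pattern_encode v = pattern_encode w"
  let ?e = "\<lambda>(i, a). prod_encode (list_encode i, a)"
  have "inj ?e" by (auto simp: inj_def list_encode_eq)
  moreover have "finite (Map.graph v)" "finite (Map.graph w)"
    using assms by (auto simp: patterns_def)
  ultimately have "Map.graph v = Map.graph w"
    using eq unfolding pattern_encode_def by (simp add: set_encode_eq inj_image_eq_iff)
  then have "v k = Some a \<longleftrightarrow> w k = Some a" for k a
    by (auto simp: Map.graph_def)
  then show "v = w" by (metis ext option.exhaust)
qed simp

lemma map_of_zip_in_patterns: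
  assumes "finite G" and "finite A" and "vs \<in> set (local_patterns G A r)"
  shows "map_of (zip (ball_words G r) vs) \<in> patterns G A"
proof -
  have "length vs = length (ball_words G r)" and vs: "set vs \<subseteq> A"
    using assms by (auto simp: set_local_patterns)
  then have "dom (map_of (zip (ball_words G r) vs)) \<subseteq> lists G"
    using assms(1) by (auto simp: set_ball_words)
  moreover have "ran (map_of (zip (ball_words G r) vs)) \<subseteq> A"
    using vs by (auto simp: ran_def dest!: map_of_SomeD set_zip_rightD)
  ultimately show ?thesis
    by (simp only: patterns_def finite_dom_map_of mem_Collect_eq simp_thms)
qed

section \<open>Compositions of block maps on a subshift over a group\<close>

locale group_subshift =
  fixes G :: "nat set" and R :: "(nat list \<times> nat list) set" and A :: "nat set" and X :: "config set"
  assumes finite_G: "finite G"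
    and congruence: "monoid_congruence G R"
    and group: "group (quotient_monoid G R)"
    and finite_A: "finite A"
    and A_nonempty: "A \<noteq> {}"
    and subshift: "subshift G R A X"
begin

abbreviation M where "M \<equiv> quotient_monoid G R"

abbreviation endo :: "nat list \<Rightarrow> config \<Rightarrow> config" where
  "endo u \<equiv> word_value (End_monoid G R A X) (block_endo G R A X) u"

lemma proj_class_closed: "i \<in> lists G \<Longrightarrow> proj_class R i \<in> carrier M"
  by (simp add: quotient_monoid_def proj_class_def quotientI)

lemma carrier_proj_class:
  assumes "g \<in> carrier M"
  obtains i where "i \<in> lists G" "g = proj_class R i"
  using assms that unfolding quotient_monoid_def proj_class_def quotient_def by auto

text \<open>The congruence makes all classes in the double union equal, and reflexivity makes the
  index sets nonempty.\<close>

lemma mult_proj_class: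
  assumes "i \<in> lists G" and "j \<in> lists G"
  shows "proj_class R i \<otimes>\<^bsub>M\<^esub> proj_class R j = proj_class R (i @ j)"
proof -
  have equiv: "equiv (lists G) R" and
    cong: "\<And>u u' v v'. (u, u') \<in> R \<Longrightarrow> (v, v') \<in> R \<Longrightarrow> (u @ v, u' @ v') \<in> R"
    using congruence by (auto simp: monoid_congruence_def)
  have "proj_class R (u @ v) = proj_class R (i @ j)" if "u \<in> proj_class R i" "v \<in> proj_class R j" for u v
    using that equiv_class_eq[OF equiv cong] by (simp add: proj_class_def)
  then have "(\<Union>u\<in>proj_class R i. \<Union>v\<in>proj_class R j. proj_class R (u @ v)) =
      (\<Union>u\<in>proj_class R i. \<Union>v\<in>proj_class R j. proj_class R (i @ j))"
    by (intro SUP_cong refl)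
  moreover have "i \<in> proj_class R i" "j \<in> proj_class R j"
    using equiv_class_self[OF equiv assms(1)] equiv_class_self[OF equiv assms(2)]
    by (simp_all add: proj_class_def)
  ultimately show ?thesis
    by (auto simp: quotient_monoid_def)
qed

lemma mult_proj_class_append:
  assumes "g \<in> carrier M" and "i \<in> lists G" and "j \<in> lists G"
  shows "(g \<otimes>\<^bsub>M\<^esub> proj_class R i) \<otimes>\<^bsub>M\<^esub> proj_class R j = g \<otimes>\<^bsub>M\<^esub> proj_class R (i @ j)"
  using assms(1)
proof (rule carrier_proj_class)
  fix h assume "h \<in> lists G" "g = proj_class R h"
  then show ?thesis using assms by (simp add: mult_proj_class)
qed

lemma mult_proj_class_Nil: "g \<in> carrier M \<Longrightarrow> g \<otimes>\<^bsub>M\<^esub> proj_class R [] = g"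
  by (erule carrier_proj_class) (simp add: mult_proj_class)

lemma subshift_subset: "X \<subseteq> carrier M \<rightarrow>\<^sub>E A"
  using subshift closedin_subset[of "full_shift G R A" X] by (simp add: subshift_def full_shift_def)

text \<open>The head of a word acts last, which is why \<open>apply_blocks\<close> is also a
  \<open>foldr\<close>.\<close>

lemma endo_Cons: "x \<in> X \<Longrightarrow> endo (n # u) x = block_endo G R A X n (endo u x)"
  by (simp add: word_value_def End_monoid_def compose_def)

text \<open>\<open>block_endo\<close> is \<open>undefined\<close> outside \<open>X\<close>, so a
  further letter can be evaluated only on intermediate configurations known to lie in
  \<open>X\<close>.\<close>

lemma endo_maps_to:
  "u \<in> lists (endo_indices G R A X) \<Longrightarrow> x \<in> X \<Longrightarrow> endo u x \<in> X"
proof (induction u)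
  case Nil
  then show ?case by (simp add: word_value_def End_monoid_def)
next
  case (Cons n u)
  then have "block_endo G R A X n \<in> carrier (End_monoid G R A X)"
    by (simp add: endo_indices_def)
  then have "block_endo G R A X n ` X \<subseteq> X"
    using subshift closedin_subset[of "full_shift G R A" X]
    by (auto simp: End_monoid_def continuous_map_def subshift_def Pi_iff topspace_subtopology_subset)
  then show ?case
    using Cons by (simp add: endo_Cons image_subset_iff)
qed

text \<open>Elements of the monoid are compared as total functions; this reduces their equality to
  equality on \<open>X\<close>.\<close>

lemma endo_extensional: "endo u \<in> extensional X"
  by (cases u) (auto simp: word_value_def End_monoid_def)

text \<open>A letter of radius \<open>r\<close> spends \<open>r\<close> of the margin between
  \<open>length i\<close> and \<open>s\<close>. Only the empty word matters in the end, but the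
  induction needs all words that still have enough margin. Reading cells relative to an arbitrary
  \<open>g\<close> makes the result usable at every position.\<close>

lemma lookup_apply_blocks:
  assumes "u \<in> lists (endo_indices G R A X)" and "x \<in> X" and "g \<in> carrier M"
    and "\<And>i. i \<in> lists G \<Longrightarrow> length i \<le> s \<Longrightarrow> lookup ps i = x (g \<otimes>\<^bsub>M\<^esub> proj_class R i)"
    and "i \<in> lists G" and "length i + total_radius G A u \<le> s"
  shows "lookup (apply_blocks G A (ball_words G s) u ps) i = endo u x (g \<otimes>\<^bsub>M\<^esub> proj_class R i)"
  using assms(1,5,6)
proof (induction u arbitrary: i)
  case Nil
  then show ?case
    using assms by (simp add: apply_blocks_def total_radius_def word_value_def End_monoid_def)
next
  case (Cons n u)
  define r where "r = block_radius G A n"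
  define y where "y = endo u x"
  define qs where "qs = apply_blocks G A (ball_words G s) u ps"
  have y: "y \<in> X" unfolding y_def using Cons assms by (intro endo_maps_to) auto
  have gi: "g \<otimes>\<^bsub>M\<^esub> proj_class R i \<in> carrier M"
    using group Cons assms by (intro monoid.m_closed proj_class_closed group.is_monoid) auto
  let ?w = "\<lambda>j\<in>set (ball_words G r). y ((g \<otimes>\<^bsub>M\<^esub> proj_class R i) \<otimes>\<^bsub>M\<^esub> proj_class R j)"
  have w: "?w \<in> set (ball_words G r) \<rightarrow>\<^sub>E A"
  proof (intro restrict_PiE_iff[THEN iffD2] ballI)
    fix j assume "j \<in> set (ball_words G r)"
    then have "(g \<otimes>\<^bsub>M\<^esub> proj_class R i) \<otimes>\<^bsub>M\<^esub> proj_class R j \<in> carrier M"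
      using finite_G
      by (intro monoid.m_closed[OF group.is_monoid[OF group] gi] proj_class_closed)
        (simp add: set_ball_words)
    then show "y ((g \<otimes>\<^bsub>M\<^esub> proj_class R i) \<otimes>\<^bsub>M\<^esub> proj_class R j) \<in> A"
      using y subshift_subset by auto
  qed
  \<comment> \<open>Appending \<open>j\<close> lengthens the word by at most \<open>r\<close>,
    exactly the share of the total radius that \<open>n\<close> contributed, so the induction
    hypothesis still applies.\<close>
  have "lookup qs (i @ j) = ?w j" if j: "j \<in> set (ball_words G r)" for j
  proof -
    have "j \<in> lists G" "length j \<le> r" using j finite_G by (auto simp: set_ball_words)
    then have "lookup qs (i @ j) = y (g \<otimes>\<^bsub>M\<^esub> proj_class R (i @ j))"
      unfolding qs_def y_def using Cons.prems
      by (intro Cons.IH) (auto simp: total_radius_def r_def)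
    then show ?thesis
      using j \<open>j \<in> lists G\<close> Cons.prems assms(3) by (simp add: mult_proj_class_append)
  qed
  then have window: "map (\<lambda>j. lookup qs (i @ j)) (ball_words G r) = map ?w (ball_words G r)"
    by simp
  have "i \<in> set (ball_words G s)"
    using Cons.prems finite_G by (simp add: set_ball_words)
  then have "lookup (apply_block G A (ball_words G s) n qs) i =
      lookup (zip (local_patterns G A r) (snd (block_map_enum G A n)))
        (map (\<lambda>j. lookup qs (i @ j)) (ball_words G r))"
    by (simp add: apply_block_def lookup_map r_def)
  also have "\<dots> = block_map G A n ?w"
    unfolding window using block_map_eq_lookup[OF finite_A A_nonempty w[unfolded r_def]]
    by (simp only: r_def)
  also have "\<dots> = block_endo G R A X n y (g \<otimes>\<^bsub>M\<^esub> proj_class R i)"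
    using y gi by (simp add: block_endo_def r_def)
  finally show ?case
    using assms(2) by (simp add: apply_blocks_def qs_def y_def endo_Cons)
qed

text \<open>If the endomorphisms agree, a separating pattern shown by some configuration at the
  identity would receive one and the same value twice. If they differ at \<open>g\<close>, the
  pattern seen from \<open>g\<close> separates them, and shifting by \<open>g\<close> exhibits it in
  the language.\<close>

lemma endo_eq_iff:
  assumes u: "u \<in> lists (endo_indices G R A X)" and v: "v \<in> lists (endo_indices G R A X)"
  defines "s \<equiv> total_radius G A (u @ v)"
  defines "B \<equiv> ball_words G s"
  shows "endo u = endo v \<longleftrightarrow>
    (\<forall>vs\<in>set (separating_patterns G A B u v (local_patterns G A s)).
       map_of (zip B vs) \<in> colanguage G R A X)"
proof -
  have B: "set B = {w \<in> lists G. length w \<le> s}"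
    using finite_G by (simp add: B_def set_ball_words)
  have radius: "total_radius G A u \<le> s" "total_radius G A v \<le> s"
    by (auto simp: s_def total_radius_def)
  have eval: "lookup (apply_blocks G A B t (zip B vs)) [] = endo t x g"
    if "t = u \<or> t = v" and "x \<in> X" and "g \<in> carrier M"
      and "\<And>i. i \<in> set B \<Longrightarrow> map_of (zip B vs) i = Some (x (g \<otimes>\<^bsub>M\<^esub> proj_class R i))" for t x g vs
  proof -
    have "lookup (apply_blocks G A B t (zip B vs)) [] = endo t x (g \<otimes>\<^bsub>M\<^esub> proj_class R [])"
      unfolding B_def
      by (rule lookup_apply_blocks) (use that u v radius B in \<open>auto simp: B_def intro!: lookup_eq\<close>)
    then show ?thesis using that by (simp add: mult_proj_class_Nil)
  qed
  have dom: "dom (map_of (zip B vs)) = set B" if "length vs = length B" for vs :: "nat list"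
    using that by simp
  show ?thesis
  proof (intro iffI ballI)
    fix vs assume eq: "endo u = endo v"
      and vs: "vs \<in> set (separating_patterns G A B u v (local_patterns G A s))"
    then have vs_in: "vs \<in> set (local_patterns G A s)" by (simp add: separating_patterns_def)
    then have len: "length vs = length B"
      using finite_A by (simp add: set_local_patterns B_def)
    have "map_of (zip B vs) \<in> patterns G A"
      unfolding B_def by (rule map_of_zip_in_patterns[OF finite_G finite_A vs_in])
    moreover have "map_of (zip B vs) \<notin> language G R A X"
    proof
      assume "map_of (zip B vs) \<in> language G R A X"
      then obtain x where x: "x \<in> X" "\<And>i. i \<in> set B \<Longrightarrow> map_of (zip B vs) i = Some (x (proj_class R i))"
        using dom[OF len] by (auto simp: language_def)
      have Nil: "proj_class R [] \<in> carrier M" by (simp add: proj_class_closed)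
      have "proj_class R [] \<otimes>\<^bsub>M\<^esub> proj_class R i = proj_class R i" if "i \<in> set B" for i
        using that B by (simp add: mult_proj_class)
      then have "lookup (apply_blocks G A B t (zip B vs)) [] = endo t x (proj_class R [])"
        if "t = u \<or> t = v" for t
        using that x Nil by (intro eval) auto
      then show False using vs eq by (simp add: separating_patterns_def)
    qed
    ultimately show "map_of (zip B vs) \<in> colanguage G R A X"
      by (simp add: colanguage_def)
  next
    assume sep: "\<forall>vs\<in>set (separating_patterns G A B u v (local_patterns G A s)).
       map_of (zip B vs) \<in> colanguage G R A X"
    have "endo u x g = endo v x g" if x: "x \<in> X" and g: "g \<in> carrier M" for x g
    proof (rule ccontr)
      assume neq: "endo u x g \<noteq> endo v x g"
      \<comment> \<open>The witness is the pattern that \<open>x\<close> shows around the position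
        \<open>g\<close> where the two images differ.\<close>
      define vs where "vs = map (\<lambda>i. x (g \<otimes>\<^bsub>M\<^esub> proj_class R i)) B"
      have cell: "map_of (zip B vs) i = Some (x (g \<otimes>\<^bsub>M\<^esub> proj_class R i))" if "i \<in> set B" for i
        using that by (simp add: vs_def map_of_zip_map)
      have "x (g \<otimes>\<^bsub>M\<^esub> proj_class R i) \<in> A" if "i \<in> set B" for i
      proof (rule PiE_mem[OF subsetD[OF subshift_subset x]])
        have "i \<in> lists G" using that B by blast
        then show "g \<otimes>\<^bsub>M\<^esub> proj_class R i \<in> carrier M"
          by (intro monoid.m_closed[OF group.is_monoid[OF group] g] proj_class_closed)
      qed
      then have "vs \<in> set (local_patterns G A s)"
        using finite_A by (auto simp: set_local_patterns vs_def B_def)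
      then have "vs \<in> set (separating_patterns G A B u v (local_patterns G A s))"
        using neq eval[OF _ x g cell] by (simp add: separating_patterns_def)
      then have "map_of (zip B vs) \<in> colanguage G R A X"
        using sep by blast
      moreover have "map_of (zip B vs) \<in> language G R A X"
      proof -
        have "map_of (zip B vs) \<in> patterns G A"
          using \<open>map_of (zip B vs) \<in> colanguage G R A X\<close> by (simp add: colanguage_def)
        \<comment> \<open>Shift invariance of \<open>X\<close> moves the pattern from
          \<open>g\<close> to the identity, where \<open>language\<close> looks for it.\<close>
        moreover have "shift G R g x \<in> X"
          using subshift x g by (simp add: subshift_def)
        moreover have "map_of (zip B vs) i = Some (shift G R g x (proj_class R i))" if "i \<in> set B" for i
          using cell[OF that] that B by (simp add: shift_def proj_class_closed)
        ultimately show ?thesis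
          using dom[of vs] by (auto simp: language_def vs_def)
      qed
      ultimately show False by (simp add: colanguage_def)
    qed
    then have "endo u x = endo v x" if "x \<in> X" for x
      using that endo_maps_to[OF u that] endo_maps_to[OF v that] subshift_subset
      by (intro PiE_ext[of _ "carrier M" "\<lambda>_. A"]) auto
    then show "endo u = endo v"
      by (intro extensionalityI[OF endo_extensional endo_extensional])
  qed
qed

lemma separating_code_correct:
  assumes "u \<in> lists (endo_indices G R A X)" and "v \<in> lists (endo_indices G R A X)"
  shows "set_decode (separating_code G A u v) \<subseteq> pattern_encode ` colanguage G R A X \<longleftrightarrow>
    endo u = endo v"
proof -
  define s where "s = total_radius G A (u @ v)"
  define B where "B = ball_words G s"
  define S where "S = set (separating_patterns G A B u v (local_patterns G A s))"
  have S: "length vs = length B" "map_of (zip B vs) \<in> patterns G A" if "vs \<in> S" for vs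
    using that finite_A map_of_zip_in_patterns[OF finite_G finite_A, of vs s]
    by (simp_all add: S_def separating_patterns_def set_local_patterns B_def)
  have "set_decode (separating_code G A u v) = (\<lambda>vs. set_encode (set (map enc (zip B vs)))) ` S"
    by (simp add: separating_code_def s_def B_def S_def)
  also have "\<dots> = (\<lambda>vs. pattern_encode (map_of (zip B vs))) ` S"
    using S distinct_ball_words[of G s]
    by (intro image_cong refl) (simp only: pattern_encode_map_of_zip B_def)
  finally have "set_decode (separating_code G A u v) \<subseteq> pattern_encode ` colanguage G R A X \<longleftrightarrow>
    (\<forall>vs\<in>S. pattern_encode (map_of (zip B vs)) \<in> pattern_encode ` colanguage G R A X)"
    by auto
  also have "\<dots> \<longleftrightarrow> (\<forall>vs\<in>S. map_of (zip B vs) \<in> colanguage G R A X)"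
    \<comment> \<open>Injectivity of the code applies because both the queried patterns and those of
      the colanguage are in \<open>patterns G A\<close>.\<close>
    using S pattern_encode_eq_iff[of _ G A] by (fastforce simp: colanguage_def)
  also have "\<dots> \<longleftrightarrow> endo u = endo v"
    using endo_eq_iff[OF assms] by (simp add: S_def B_def s_def)
  finally show ?thesis .
qed

end

theorem theorem2:
  fixes G A :: "nat set"
    and R :: "(nat list \<times> nat list) set"
    and X :: "config set"
  assumes "finite G"
    and "monoid_congruence G R"
    and "effective_group G R"
    and "finite A"
    and "card A \<ge> 2"
    and "subshift G R A X"
  shows "positive_reducible
           (word_pair_encode ` (lists (endo_indices G R A X) \<times> lists (endo_indices G R A X)))
           (word_pair_encode `
              equality_problem (End_monoid G R A X) (endo_indices G R A X) (block_endo G R A X))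
           (pattern_encode ` colanguage G R A X)"
proof -
  interpret group_subshift G R A X
    using assms by (intro group_subshift.intro) (auto simp: effective_group_def)
  have "effective (\<lambda>p. [separating_code G A (fst p) (snd p)])"
    by (intro effective effective_separating_code finite_A A_nonempty)
  then obtain f where f: "computable f"
    "\<And>p. f (enc p) = enc [separating_code G A (fst p) (snd p)]"
    unfolding effective_def by blast
  \<comment> \<open>Naturals are their own codes, so \<open>enc\<close> on pairs of words is
    \<open>word_pair_encode\<close>.\<close>
  have "map enc w = w" for w :: "nat list"
    by (induction w) auto
  then have code: "f (word_pair_encode (u, v)) = list_encode [separating_code G A u v]" for u v
    using f(2)[of "(u, v)"] by (simp add: word_pair_encode_def)
  have inj: "word_pair_encode p = word_pair_encode q \<longleftrightarrow> p = q" for p q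
    by (auto simp: word_pair_encode_def list_encode_eq split: prod.splits)
  show ?thesis
    unfolding positive_reducible_def
  proof (rule exI[of _ f], intro conjI ballI f(1))
    fix x assume "x \<in> word_pair_encode ` (lists (endo_indices G R A X) \<times> lists (endo_indices G R A X))"
    then obtain u v where x: "x = word_pair_encode (u, v)"
      and u: "u \<in> lists (endo_indices G R A X)" and v: "v \<in> lists (endo_indices G R A X)"
      by auto
    have "x \<in> word_pair_encode `
        equality_problem (End_monoid G R A X) (endo_indices G R A X) (block_endo G R A X) \<longleftrightarrow>
      endo u = endo v"
      using u v by (auto simp: x image_iff inj equality_problem_def)
    also have "\<dots> \<longleftrightarrow> (\<exists>s\<in>set (list_decode (f x)). set_decode s \<subseteq> pattern_encode ` colanguage G R A X)"
      by (simp only: x code list_encode_inverse) (simp add: separating_code_correct[OF u v])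
    finally show "x \<in> word_pair_encode `
        equality_problem (End_monoid G R A X) (endo_indices G R A X) (block_endo G R A X) \<longleftrightarrow>
      (\<exists>s\<in>set (list_decode (f x)). set_decode s \<subseteq> pattern_encode ` colanguage G R A X)" .
  qed
qed

end
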